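(* Let $\mathcal{C}$ be a locally finite, extensive, and combinatorial category. Let $C_i$ $(i\in I)$ be representatives of the set of isomorphism classes of connected objects of $\mathcal{C}$. Then $$\prod_{i\in I}h_{C_i}:(\operatorname{Dec}(\mathcal{C}),+)\to\prod_{i\in I}(\mathbb{N},+)$$ is an injective morphism of monoids. If, moreover, $\mathcal{C}$ has finite products, then $$\prod_{i\in I}h_{C_i}:(\operatorname{Dec}(\mathcal{C}),+,\times)\to\prod_{i\in I}(\mathbb{N},+,\times)$$ is an injective morphism of semi-rings.
   Context: A category is locally finite if the hom-set between any two objects is a finite set. The coproduct is written $A+B$, the initial object is $0$, and the canonical morphism $i_A:A\to A+B$ is called a coprojection. In a category with finite coproducts, an object $C$ is connected if for all objects $A,B$ the natural map $\operatorname{Hom}(C,A)\coprod\operatorname{Hom}(C,B)\to\operatorname{Hom}(C,A+B)$ is bijective. A category is extensive if it has finite coproducts and: (i) for any morphism $f:A\to X_1+X_2$, the pullback of $f$ along the coprojection $i_{X_1}:X_1\to X_1+X_2$ exists; (ii) for any commutative diagram consisting of a row $A_1\to A\leftarrow A_2$, the row $X_1\xrightarrow{i_{X_1}}X_1+X_2\xleftarrow{i_{X_2}}X_2$, and vertical morphisms $A_1\to X_1$, $f:A\to X_1+X_2$, $A_2\to X_2$, the row $A_1\to A\leftarrow A_2$ is a coproduct diagram if and only if both squares are pullbacks. A locally finite category is combinatorial if, whenever two objects $A,B$ satisfy $\#\operatorname{Hom}(X,A)=\#\operatorname{Hom}(X,B)$ for all objects $X$, then $A\cong B$. $\operatorname{Dec}(\mathcal{C})$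 is the set of isomorphism classes $[A]$ of objects of $\mathcal{C}$. $(\operatorname{Dec}(\mathcal{C}),+)$ is the monoid with $[A]+[B]=[A+B]$ and unit $[0]$. When $\mathcal{C}$ has finite products, $\times$ is given by $[A]\times[B]=[A\times B]$ with unit the class of the terminal object; it is known that an extensive category with finite products is distributive (the natural morphism $A\times B+A\times C\to A\times(B+C)$ is an isomorphism, and $A\times 0\cong 0$), so $(\operatorname{Dec}(\mathcal{C}),+,\times)$ is a semi-ring. For an object $D$ of a locally finite category, $h_D:\operatorname{Dec}(\mathcal{C})\to\mathbb{N}$ is $[A]\mapsto\#\operatorname{Hom}(D,A)$. $\mathbb{N}$ is the semi-ring of non-negative integers. Monoids are commutative. A semi-ring is a set with two commutative monoid structures $(+,0)$ and $(\times,1)$ satisfying the distributive laws and $0\times x=0$ for all $x$; morphisms of monoids and of semi-rings preserve all operations and units. *)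

theory Defs
  imports "HOL-Algebra.Ring" "HOL-Algebra.Product_Groups"
begin

section \<open>Categories\<close>

record ('o, 'm) category =
  Obj :: "'o set"
  Arr :: "'m set"
  Dom :: "'m \<Rightarrow> 'o"
  Cod :: "'m \<Rightarrow> 'o"
  Idn :: "'o \<Rightarrow> 'm"
  Cmp :: "'m \<Rightarrow> 'm \<Rightarrow> 'm" (infixr \<open>\<cdot>\<index>\<close> 70)

definition Hom :: "('o, 'm) category \<Rightarrow> 'o \<Rightarrow> 'o \<Rightarrow> 'm set" where
  "Hom \<C> A B = {f \<in> Arr \<C>. Dom \<C> f = A \<and> Cod \<C> f = B}"

text \<open>Composition is written in the usual order: \<open>g \<cdot>\<^bsub>\<C>\<^esub> f\<close> is \<open>g\<close> after \<open>f\<close>. It is only constrained on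
  composable arrows, and all notions below only use it there.\<close>

locale category =
  fixes \<C> :: "('o, 'm) category" (structure)
  assumes Dom_Obj: "f \<in> Arr \<C> \<Longrightarrow> Dom \<C> f \<in> Obj \<C>"
    and Cod_Obj: "f \<in> Arr \<C> \<Longrightarrow> Cod \<C> f \<in> Obj \<C>"
    and Idn_Hom: "A \<in> Obj \<C> \<Longrightarrow> Idn \<C> A \<in> Hom \<C> A A"
    and Cmp_Hom: "\<lbrakk>f \<in> Hom \<C> A B; g \<in> Hom \<C> B D\<rbrakk> \<Longrightarrow> g \<cdot> f \<in> Hom \<C> A D"
    and Cmp_assoc: "\<lbrakk>f \<in> Hom \<C> A B; g \<in> Hom \<C> B D; h \<in> Hom \<C> D E\<rbrakk> \<Longrightarrow> h \<cdot> (g \<cdot> f) = (h \<cdot> g) \<cdot> f"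
    and Idn_left: "f \<in> Hom \<C> A B \<Longrightarrow> Idn \<C> B \<cdot> f = f"
    and Idn_right: "f \<in> Hom \<C> A B \<Longrightarrow> f \<cdot> Idn \<C> A = f"

definition isomorphic :: "('o, 'm) category \<Rightarrow> 'o \<Rightarrow> 'o \<Rightarrow> bool" where
  "isomorphic \<C> A B \<longleftrightarrow>
     (\<exists>f\<in>Hom \<C> A B. \<exists>g\<in>Hom \<C> B A. g \<cdot>\<^bsub>\<C>\<^esub> f = Idn \<C> A \<and> f \<cdot>\<^bsub>\<C>\<^esub> g = Idn \<C> B)"

definition locally_finite :: "('o, 'm) category \<Rightarrow> bool" where
  "locally_finite \<C> \<longleftrightarrow> (\<forall>A\<in>Obj \<C>. \<forall>B\<in>Obj \<C>. finite (Hom \<C> A B))"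


section \<open>Finite coproducts, finite products and pullbacks\<close>

definition is_initial :: "('o, 'm) category \<Rightarrow> 'o \<Rightarrow> bool" where
  "is_initial \<C> Z \<longleftrightarrow> Z \<in> Obj \<C> \<and> (\<forall>X\<in>Obj \<C>. \<exists>!f. f \<in> Hom \<C> Z X)"

definition is_terminal :: "('o, 'm) category \<Rightarrow> 'o \<Rightarrow> bool" where
  "is_terminal \<C> T \<longleftrightarrow> T \<in> Obj \<C> \<and> (\<forall>X\<in>Obj \<C>. \<exists>!f. f \<in> Hom \<C> X T)"

text \<open>\<open>is_coproduct \<C> A B S i j\<close>: the row \<open>A \<rightarrow> S \<leftarrow> B\<close> with arrows \<open>i\<close> and \<open>j\<close> is a coproduct diagram.\<close>

definition is_coproduct ::
    "('o, 'm) category \<Rightarrow> 'o \<Rightarrow> 'o \<Rightarrow> 'o \<Rightarrow> 'm \<Rightarrow> 'm \<Rightarrow> bool" where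
  "is_coproduct \<C> A B S i j \<longleftrightarrow>
     A \<in> Obj \<C> \<and> B \<in> Obj \<C> \<and> S \<in> Obj \<C> \<and> i \<in> Hom \<C> A S \<and> j \<in> Hom \<C> B S \<and>
     (\<forall>X\<in>Obj \<C>. \<forall>f\<in>Hom \<C> A X. \<forall>g\<in>Hom \<C> B X.
        \<exists>!u. u \<in> Hom \<C> S X \<and> u \<cdot>\<^bsub>\<C>\<^esub> i = f \<and> u \<cdot>\<^bsub>\<C>\<^esub> j = g)"

definition is_product ::
    "('o, 'm) category \<Rightarrow> 'o \<Rightarrow> 'o \<Rightarrow> 'o \<Rightarrow> 'm \<Rightarrow> 'm \<Rightarrow> bool" where
  "is_product \<C> A B P p q \<longleftrightarrow>
     A \<in> Obj \<C> \<and> B \<in> Obj \<C> \<and> P \<in> Obj \<C> \<and> p \<in> Hom \<C> P A \<and> q \<in> Hom \<C> P B \<and>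
     (\<forall>X\<in>Obj \<C>. \<forall>f\<in>Hom \<C> X A. \<forall>g\<in>Hom \<C> X B.
        \<exists>!u. u \<in> Hom \<C> X P \<and> p \<cdot>\<^bsub>\<C>\<^esub> u = f \<and> q \<cdot>\<^bsub>\<C>\<^esub> u = g)"

text \<open>\<open>is_pullback \<C> f k P p q\<close>: the square \<open>f \<cdot> p = k \<cdot> q\<close> with corner \<open>P\<close> is a pullback of \<open>f\<close> along \<open>k\<close>;
  \<open>f\<close> and \<open>k\<close> have a common codomain.\<close>

definition is_pullback ::
    "('o, 'm) category \<Rightarrow> 'm \<Rightarrow> 'm \<Rightarrow> 'o \<Rightarrow> 'm \<Rightarrow> 'm \<Rightarrow> bool" where
  "is_pullback \<C> f k P p q \<longleftrightarrow>
     f \<in> Arr \<C> \<and> k \<in> Arr \<C> \<and> Cod \<C> f = Cod \<C> k \<and>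
     P \<in> Obj \<C> \<and> p \<in> Hom \<C> P (Dom \<C> f) \<and> q \<in> Hom \<C> P (Dom \<C> k) \<and>
     f \<cdot>\<^bsub>\<C>\<^esub> p = k \<cdot>\<^bsub>\<C>\<^esub> q \<and>
     (\<forall>X\<in>Obj \<C>. \<forall>s\<in>Hom \<C> X (Dom \<C> f). \<forall>t\<in>Hom \<C> X (Dom \<C> k). f \<cdot>\<^bsub>\<C>\<^esub> s = k \<cdot>\<^bsub>\<C>\<^esub> t \<longrightarrow>
        (\<exists>!u. u \<in> Hom \<C> X P \<and> p \<cdot>\<^bsub>\<C>\<^esub> u = s \<and> q \<cdot>\<^bsub>\<C>\<^esub> u = t))"

definition has_finite_coproducts :: "('o, 'm) category \<Rightarrow> bool" where
  "has_finite_coproducts \<C> \<longleftrightarrow>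
     (\<exists>Z. is_initial \<C> Z) \<and>
     (\<forall>A\<in>Obj \<C>. \<forall>B\<in>Obj \<C>. \<exists>S i j. is_coproduct \<C> A B S i j)"

definition has_finite_products :: "('o, 'm) category \<Rightarrow> bool" where
  "has_finite_products \<C> \<longleftrightarrow>
     (\<exists>T. is_terminal \<C> T) \<and>
     (\<forall>A\<in>Obj \<C>. \<forall>B\<in>Obj \<C>. \<exists>P p q. is_product \<C> A B P p q)"

definition initial_obj :: "('o, 'm) category \<Rightarrow> 'o" where
  "initial_obj \<C> = (SOME Z. is_initial \<C> Z)"

definition terminal_obj :: "('o, 'm) category \<Rightarrow> 'o" where
  "terminal_obj \<C> = (SOME T. is_terminal \<C> T)"

definition coprod_obj :: "('o, 'm) category \<Rightarrow> 'o \<Rightarrow> 'o \<Rightarrow> 'o" where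
  "coprod_obj \<C> A B = (SOME S. \<exists>i j. is_coproduct \<C> A B S i j)"

definition prod_obj :: "('o, 'm) category \<Rightarrow> 'o \<Rightarrow> 'o \<Rightarrow> 'o" where
  "prod_obj \<C> A B = (SOME P. \<exists>p q. is_product \<C> A B P p q)"


section \<open>Connected objects, extensive and combinatorial categories\<close>

text \<open>A coproduct is determined only up to unique isomorphism, so conditions mentioning \<open>A + B\<close> and
  its coprojections are imposed on every coproduct diagram.\<close>

definition connected_obj :: "('o, 'm) category \<Rightarrow> 'o \<Rightarrow> bool" where
  "connected_obj \<C> K \<longleftrightarrow>
     K \<in> Obj \<C> \<and>
     (\<forall>A B S i j. is_coproduct \<C> A B S i j \<longrightarrow>
        bij_betw (case_sum (\<lambda>f. i \<cdot>\<^bsub>\<C>\<^esub> f) (\<lambda>g. j \<cdot>\<^bsub>\<C>\<^esub> g))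
          (Hom \<C> K A <+> Hom \<C> K B) (Hom \<C> K S))"

definition extensive :: "('o, 'm) category \<Rightarrow> bool" where
  "extensive \<C> \<longleftrightarrow>
     has_finite_coproducts \<C> \<and>
     (\<forall>X1 X2 S i1 i2 A f. is_coproduct \<C> X1 X2 S i1 i2 \<longrightarrow> f \<in> Hom \<C> A S \<longrightarrow>
        (\<exists>P p q. is_pullback \<C> f i1 P p q)) \<and>
     (\<forall>X1 X2 S i1 i2 A f A1 A2 a1 a2 x1 x2.
        is_coproduct \<C> X1 X2 S i1 i2 \<longrightarrow> f \<in> Hom \<C> A S \<longrightarrow>
        a1 \<in> Hom \<C> A1 A \<longrightarrow> a2 \<in> Hom \<C> A2 A \<longrightarrow>
        x1 \<in> Hom \<C> A1 X1 \<longrightarrow> x2 \<in> Hom \<C> A2 X2 \<longrightarrow>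
        f \<cdot>\<^bsub>\<C>\<^esub> a1 = i1 \<cdot>\<^bsub>\<C>\<^esub> x1 \<longrightarrow> f \<cdot>\<^bsub>\<C>\<^esub> a2 = i2 \<cdot>\<^bsub>\<C>\<^esub> x2 \<longrightarrow>
        (is_coproduct \<C> A1 A2 A a1 a2 \<longleftrightarrow>
           is_pullback \<C> f i1 A1 a1 x1 \<and> is_pullback \<C> f i2 A2 a2 x2))"

definition combinatorial :: "('o, 'm) category \<Rightarrow> bool" where
  "combinatorial \<C> \<longleftrightarrow>
     locally_finite \<C> \<and>
     (\<forall>A\<in>Obj \<C>. \<forall>B\<in>Obj \<C>.
        (\<forall>X\<in>Obj \<C>. card (Hom \<C> X A) = card (Hom \<C> X B)) \<longrightarrow> isomorphic \<C> A B)"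

definition connected_representatives :: "('o, 'm) category \<Rightarrow> 'i set \<Rightarrow> ('i \<Rightarrow> 'o) \<Rightarrow> bool" where
  "connected_representatives \<C> I K \<longleftrightarrow>
     (\<forall>i\<in>I. connected_obj \<C> (K i)) \<and>
     (\<forall>X. connected_obj \<C> X \<longrightarrow> (\<exists>!i. i \<in> I \<and> isomorphic \<C> X (K i)))"


section \<open>The monoid and the semi-ring of isomorphism classes\<close>

definition iso_rel :: "('o, 'm) category \<Rightarrow> ('o \<times> 'o) set" where
  "iso_rel \<C> = {(A, B). A \<in> Obj \<C> \<and> B \<in> Obj \<C> \<and> isomorphic \<C> A B}"

abbreviation iso_class :: "('o, 'm) category \<Rightarrow> 'o \<Rightarrow> 'o set" where
  "iso_class \<C> A \<equiv> iso_rel \<C> `` {A}"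

definition Dec :: "('o, 'm) category \<Rightarrow> 'o set set" where
  "Dec \<C> = Obj \<C> // iso_rel \<C>"

text \<open>The operations on classes are lifted by taking unions over representatives, as usual for
  quotients; the lemmas \<open>Dec_add_class\<close>, \<open>Dec_mult_class\<close> and \<open>hom_count_class\<close> below show that they
  have the intended values.\<close>

definition Dec_add :: "('o, 'm) category \<Rightarrow> 'o set \<Rightarrow> 'o set \<Rightarrow> 'o set" where
  "Dec_add \<C> X Y = (\<Union>A\<in>X. \<Union>B\<in>Y. iso_class \<C> (coprod_obj \<C> A B))"

definition Dec_mult :: "('o, 'm) category \<Rightarrow> 'o set \<Rightarrow> 'o set \<Rightarrow> 'o set" where
  "Dec_mult \<C> X Y = (\<Union>A\<in>X. \<Union>B\<in>Y. iso_class \<C> (prod_obj \<C> A B))"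

definition Dec_monoid :: "('o, 'm) category \<Rightarrow> 'o set monoid" where
  "Dec_monoid \<C> =
     \<lparr>carrier = Dec \<C>, monoid.mult = Dec_add \<C>, one = iso_class \<C> (initial_obj \<C>)\<rparr>"

definition Dec_semiring :: "('o, 'm) category \<Rightarrow> 'o set ring" where
  "Dec_semiring \<C> =
     \<lparr>carrier = Dec \<C>, monoid.mult = Dec_mult \<C>, one = iso_class \<C> (terminal_obj \<C>),
      zero = iso_class \<C> (initial_obj \<C>), add = Dec_add \<C>\<rparr>"

definition hom_count :: "('o, 'm) category \<Rightarrow> 'o \<Rightarrow> 'o set \<Rightarrow> nat" where
  "hom_count \<C> D X = the_elem ((\<lambda>A. card (Hom \<C> D A)) ` X)"

definition hom_counts ::
    "('o, 'm) category \<Rightarrow> 'i set \<Rightarrow> ('i \<Rightarrow> 'o) \<Rightarrow> 'o set \<Rightarrow> 'i \<Rightarrow> nat" where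
  "hom_counts \<C> I K = (\<lambda>X\<in>Dec \<C>. \<lambda>i\<in>I. hom_count \<C> (K i) X)"


section \<open>Monoids, semi-rings and their morphisms\<close>

definition nat_monoid :: "nat monoid" where
  "nat_monoid = \<lparr>carrier = UNIV, monoid.mult = (+), one = 0\<rparr>"

definition nat_semiring :: "nat ring" where
  "nat_semiring = \<lparr>carrier = UNIV, monoid.mult = (*), one = 1, zero = 0, add = (+)\<rparr>"

text \<open>Despite its name, \<^const>\<open>product_group\<close> is the direct product of arbitrary monoids; the following
  is its analogue for structures with two operations.\<close>

definition product_semiring :: "'i set \<Rightarrow> ('i \<Rightarrow> 'a ring) \<Rightarrow> ('i \<Rightarrow> 'a) ring" where
  "product_semiring I R =
     \<lparr>carrier = (\<Pi>\<^sub>E i\<in>I. carrier (R i)),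
      monoid.mult = (\<lambda>x y. \<lambda>i\<in>I. x i \<otimes>\<^bsub>R i\<^esub> y i), one = (\<lambda>i\<in>I. \<one>\<^bsub>R i\<^esub>),
      zero = (\<lambda>i\<in>I. \<zero>\<^bsub>R i\<^esub>), add = (\<lambda>x y. \<lambda>i\<in>I. x i \<oplus>\<^bsub>R i\<^esub> y i)\<rparr>"

text \<open>\<^const>\<open>hom\<close> does not require preservation of the unit, and \<^const>\<open>ring_hom\<close> does not require
  preservation of zero; neither is automatic without inverses. Monoids and semi-rings are
  commutative, and being one is part of being the source or target of a morphism.\<close>

definition monoid_morphism :: "'a monoid \<Rightarrow> 'b monoid \<Rightarrow> ('a \<Rightarrow> 'b) \<Rightarrow> bool" where
  "monoid_morphism M N h \<longleftrightarrow>
     comm_monoid M \<and> comm_monoid N \<and> h \<in> hom M N \<and> h \<one>\<^bsub>M\<^esub> = \<one>\<^bsub>N\<^esub>"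

definition comm_semiring :: "'a ring \<Rightarrow> bool" where
  "comm_semiring R \<longleftrightarrow> semiring R \<and> comm_monoid R"

definition semiring_morphism :: "'a ring \<Rightarrow> 'b ring \<Rightarrow> ('a \<Rightarrow> 'b) \<Rightarrow> bool" where
  "semiring_morphism R S h \<longleftrightarrow>
     comm_semiring R \<and> comm_semiring S \<and> h \<in> ring_hom R S \<and> h \<zero>\<^bsub>R\<^esub> = \<zero>\<^bsub>S\<^esub>"


section \<open>Well-definedness of the operations on isomorphism classes\<close>

context category
begin

lemma Hom_Obj: "f \<in> Hom \<C> A B \<Longrightarrow> A \<in> Obj \<C> \<and> B \<in> Obj \<C>"
  using Dom_Obj Cod_Obj by (auto simp: Hom_def)

lemma isomorphic_refl: "A \<in> Obj \<C> \<Longrightarrow> isomorphic \<C> A A"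
  unfolding isomorphic_def using Idn_Hom Idn_left by blast

lemma isomorphic_sym: "isomorphic \<C> A B \<Longrightarrow> isomorphic \<C> B A"
  unfolding isomorphic_def by blast

lemma Cmp_cancel_left:
  assumes "f \<in> Hom \<C> A B" "g \<in> Hom \<C> B A" "g \<cdot> f = Idn \<C> A" "k \<in> Hom \<C> X A"
  shows "g \<cdot> (f \<cdot> k) = k"
  using assms Cmp_assoc Idn_left by metis

lemma Cmp_cancel_right:
  assumes "f \<in> Hom \<C> A B" "g \<in> Hom \<C> B A" "g \<cdot> f = Idn \<C> A" "k \<in> Hom \<C> A X"
  shows "(k \<cdot> g) \<cdot> f = k"
  using assms Cmp_assoc Idn_right by metis

lemma isomorphic_trans:
  assumes "isomorphic \<C> A B" "isomorphic \<C> B D"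
  shows "isomorphic \<C> A D"
proof -
  obtain f g where f: "f \<in> Hom \<C> A B" and g: "g \<in> Hom \<C> B A"
    and gf: "g \<cdot> f = Idn \<C> A" and fg: "f \<cdot> g = Idn \<C> B"
    using assms(1) unfolding isomorphic_def by blast
  obtain h k where h: "h \<in> Hom \<C> B D" and k: "k \<in> Hom \<C> D B"
    and kh: "k \<cdot> h = Idn \<C> B" and hk: "h \<cdot> k = Idn \<C> D"
    using assms(2) unfolding isomorphic_def by blast
  have "(g \<cdot> k) \<cdot> (h \<cdot> f) = Idn \<C> A"
    using Cmp_assoc[OF Cmp_Hom[OF f h] k g] Cmp_cancel_left[OF h k kh f] gf by simp
  moreover have "(h \<cdot> f) \<cdot> (g \<cdot> k) = Idn \<C> D"
    using Cmp_assoc[OF Cmp_Hom[OF k g] f h] Cmp_cancel_left[OF g f fg k] hk by simp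
  ultimately show ?thesis
    unfolding isomorphic_def using Cmp_Hom[OF f h] Cmp_Hom[OF k g] by blast
qed

lemma equiv_iso_rel: "equiv (Obj \<C>) (iso_rel \<C>)"
  by (rule equivI)
    (auto simp: iso_rel_def refl_on_def sym_def trans_def
          intro: isomorphic_refl isomorphic_sym isomorphic_trans)

lemma iso_class_in_Dec: "A \<in> Obj \<C> \<Longrightarrow> iso_class \<C> A \<in> Dec \<C>"
  by (simp add: Dec_def quotientI)

lemma coproduct_unique:
  assumes "isomorphic \<C> A A'" "isomorphic \<C> B B'"
    and S: "is_coproduct \<C> A B S i j" and S': "is_coproduct \<C> A' B' S' i' j'"
  shows "isomorphic \<C> S S'"
proof -
  have ex: "\<exists>u\<in>Hom \<C> S S'. u \<cdot> i = i' \<cdot> f \<and> u \<cdot> j = j' \<cdot> g"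
    if S: "is_coproduct \<C> A B S i j" and S': "is_coproduct \<C> A' B' S' i' j'"
      and f: "f \<in> Hom \<C> A A'" and g: "g \<in> Hom \<C> B B'"
    for A B S i j A' B' S' i' j' f g
  proof -
    have "i' \<cdot> f \<in> Hom \<C> A S'" "j' \<cdot> g \<in> Hom \<C> B S'" "S' \<in> Obj \<C>"
      using S' f g Cmp_Hom by (auto simp: is_coproduct_def)
    then show ?thesis using S unfolding is_coproduct_def by blast
  qed
  have inv: "v \<cdot> u = Idn \<C> S"
    if S: "is_coproduct \<C> A B S i j" and S': "is_coproduct \<C> A' B' S' i' j'"
      and f: "f \<in> Hom \<C> A A'" and g: "g \<in> Hom \<C> B B'"
      and f': "f' \<in> Hom \<C> A' A" and g': "g' \<in> Hom \<C> B' B"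
      and ff: "f' \<cdot> f = Idn \<C> A" and gg: "g' \<cdot> g = Idn \<C> B"
      and u: "u \<in> Hom \<C> S S'" "u \<cdot> i = i' \<cdot> f" "u \<cdot> j = j' \<cdot> g"
      and v: "v \<in> Hom \<C> S' S" "v \<cdot> i' = i \<cdot> f'" "v \<cdot> j' = j \<cdot> g'"
    for A B S i j A' B' S' i' j' f g f' g' u v
  proof -
    have i: "i \<in> Hom \<C> A S" and j: "j \<in> Hom \<C> B S" and SO: "S \<in> Obj \<C>"
      and i': "i' \<in> Hom \<C> A' S'" and j': "j' \<in> Hom \<C> B' S'"
      using S S' by (auto simp: is_coproduct_def)
    have 1: "(v \<cdot> u) \<cdot> i = i"
      using Cmp_assoc[OF i u(1) v(1)] Cmp_assoc[OF f i' v(1)] u(2) v(2)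
        Cmp_cancel_right[OF f f' ff i] by simp
    have 2: "(v \<cdot> u) \<cdot> j = j"
      using Cmp_assoc[OF j u(1) v(1)] Cmp_assoc[OF g j' v(1)] u(3) v(3)
        Cmp_cancel_right[OF g g' gg j] by simp
    have "\<exists>!w. w \<in> Hom \<C> S S \<and> w \<cdot> i = i \<and> w \<cdot> j = j"
      using S SO i j unfolding is_coproduct_def by blast
    with 1 2 show ?thesis
      using Cmp_Hom[OF u(1) v(1)] Idn_Hom[OF SO] Idn_left[OF i] Idn_left[OF j] by blast
  qed
  obtain f f' where f: "f \<in> Hom \<C> A A'" "f' \<in> Hom \<C> A' A"
    "f' \<cdot> f = Idn \<C> A" "f \<cdot> f' = Idn \<C> A'"
    using assms(1) unfolding isomorphic_def by blast
  obtain g g' where g: "g \<in> Hom \<C> B B'" "g' \<in> Hom \<C> B' B"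
    "g' \<cdot> g = Idn \<C> B" "g \<cdot> g' = Idn \<C> B'"
    using assms(2) unfolding isomorphic_def by blast
  obtain u where u: "u \<in> Hom \<C> S S'" "u \<cdot> i = i' \<cdot> f" "u \<cdot> j = j' \<cdot> g"
    using ex[OF S S' f(1) g(1)] by blast
  obtain v where v: "v \<in> Hom \<C> S' S" "v \<cdot> i' = i \<cdot> f'" "v \<cdot> j' = j \<cdot> g'"
    using ex[OF S' S f(2) g(2)] by blast
  have "v \<cdot> u = Idn \<C> S" "u \<cdot> v = Idn \<C> S'"
    using inv[OF S S' f(1) g(1) f(2) g(2) f(3) g(3) u v]
      inv[OF S' S f(2) g(2) f(1) g(1) f(4) g(4) v u] by auto
  then show ?thesis using u(1) v(1) unfolding isomorphic_def by blast
qed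

end

text \<open>Products are coproducts in the opposite category.\<close>

definition opposite :: "('o, 'm) category \<Rightarrow> ('o, 'm) category" where
  "opposite \<C> = \<lparr>Obj = Obj \<C>, Arr = Arr \<C>, Dom = Cod \<C>, Cod = Dom \<C>, Idn = Idn \<C>,
     Cmp = (\<lambda>g f. f \<cdot>\<^bsub>\<C>\<^esub> g)\<rparr>"

lemma Hom_opposite: "Hom (opposite \<C>) A B = Hom \<C> B A"
  by (auto simp: Hom_def opposite_def)

lemma is_coproduct_opposite: "is_coproduct (opposite \<C>) A B P p q = is_product \<C> A B P p q"
  unfolding is_coproduct_def is_product_def Hom_opposite by (simp add: opposite_def)

lemma isomorphic_opposite: "isomorphic (opposite \<C>) A B = isomorphic \<C> A B"
  unfolding isomorphic_def Hom_opposite by (auto simp: opposite_def)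

context category
begin

lemma category_opposite: "category (opposite \<C>)"
  by unfold_locales
    (simp_all add: Hom_opposite, auto simp: opposite_def
          intro: Dom_Obj Cod_Obj Idn_Hom Cmp_Hom Idn_left Idn_right Cmp_assoc[symmetric])

lemma product_unique:
  assumes "isomorphic \<C> A A'" "isomorphic \<C> B B'"
    and "is_product \<C> A B P p q" "is_product \<C> A' B' P' p' q'"
  shows "isomorphic \<C> P P'"
  using category.coproduct_unique[OF category_opposite] assms
  unfolding isomorphic_opposite is_coproduct_opposite by blast

lemma Dec_add_class:
  assumes "has_finite_coproducts \<C>" "A \<in> Obj \<C>" "B \<in> Obj \<C>"
  shows "Dec_add \<C> (iso_class \<C> A) (iso_class \<C> B) = iso_class \<C> (coprod_obj \<C> A B)"
proof -
  have co: "\<exists>i j. is_coproduct \<C> A B (coprod_obj \<C> A B) i j"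
    if "A \<in> Obj \<C>" "B \<in> Obj \<C>" for A B
    using assms(1) that unfolding has_finite_coproducts_def coprod_obj_def
    by (intro someI_ex[where P = "\<lambda>S. \<exists>i j. is_coproduct \<C> A B S i j"]) blast
  have "iso_class \<C> (coprod_obj \<C> A B) = iso_class \<C> (coprod_obj \<C> A' B')"
    if "(A, A') \<in> iso_rel \<C>" "(B, B') \<in> iso_rel \<C>" for A A' B B'
  proof (rule equiv_class_eq[OF equiv_iso_rel])
    from that have "A \<in> Obj \<C>" "A' \<in> Obj \<C>" "B \<in> Obj \<C>" "B' \<in> Obj \<C>"
      and iso: "isomorphic \<C> A A'" "isomorphic \<C> B B'"
      by (auto simp: iso_rel_def)
    then obtain i j i' j' where "is_coproduct \<C> A B (coprod_obj \<C> A B) i j"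
      "is_coproduct \<C> A' B' (coprod_obj \<C> A' B') i' j'"
      using co by meson
    then show "(coprod_obj \<C> A B, coprod_obj \<C> A' B') \<in> iso_rel \<C>"
      using coproduct_unique[OF iso] by (auto simp: iso_rel_def is_coproduct_def)
  qed
  then show ?thesis
    unfolding Dec_add_def using assms(2,3)
    by (intro UN_equiv_class2[OF equiv_iso_rel equiv_iso_rel] congruent2I') auto
qed

lemma Dec_mult_class:
  assumes "has_finite_products \<C>" "A \<in> Obj \<C>" "B \<in> Obj \<C>"
  shows "Dec_mult \<C> (iso_class \<C> A) (iso_class \<C> B) = iso_class \<C> (prod_obj \<C> A B)"
proof -
  have pr: "\<exists>p q. is_product \<C> A B (prod_obj \<C> A B) p q"
    if "A \<in> Obj \<C>" "B \<in> Obj \<C>" for A B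
    using assms(1) that unfolding has_finite_products_def prod_obj_def
    by (intro someI_ex[where P = "\<lambda>P. \<exists>p q. is_product \<C> A B P p q"]) blast
  have "iso_class \<C> (prod_obj \<C> A B) = iso_class \<C> (prod_obj \<C> A' B')"
    if "(A, A') \<in> iso_rel \<C>" "(B, B') \<in> iso_rel \<C>" for A A' B B'
  proof (rule equiv_class_eq[OF equiv_iso_rel])
    from that have "A \<in> Obj \<C>" "A' \<in> Obj \<C>" "B \<in> Obj \<C>" "B' \<in> Obj \<C>"
      and iso: "isomorphic \<C> A A'" "isomorphic \<C> B B'"
      by (auto simp: iso_rel_def)
    then obtain p q p' q' where "is_product \<C> A B (prod_obj \<C> A B) p q"
      "is_product \<C> A' B' (prod_obj \<C> A' B') p' q'"
      using pr by meson
    then show "(prod_obj \<C> A B, prod_obj \<C> A' B') \<in> iso_rel \<C>"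
      using product_unique[OF iso] by (auto simp: iso_rel_def is_product_def)
  qed
  then show ?thesis
    unfolding Dec_mult_def using assms(2,3)
    by (intro UN_equiv_class2[OF equiv_iso_rel equiv_iso_rel] congruent2I') auto
qed

lemma hom_count_class:
  assumes "A \<in> Obj \<C>"
  shows "hom_count \<C> D (iso_class \<C> A) = card (Hom \<C> D A)"
proof -
  have "card (Hom \<C> D B) = card (Hom \<C> D A)" if iso: "isomorphic \<C> A B" for B
  proof -
    obtain f g where f: "f \<in> Hom \<C> A B" and g: "g \<in> Hom \<C> B A"
      and gf: "g \<cdot> f = Idn \<C> A" and fg: "f \<cdot> g = Idn \<C> B"
      using iso unfolding isomorphic_def by blast
    have "bij_betw (\<lambda>k. g \<cdot> k) (Hom \<C> D B) (Hom \<C> D A)"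
    proof (rule bij_betw_byWitness[where f' = "\<lambda>k. f \<cdot> k"])
      show "\<forall>k\<in>Hom \<C> D B. f \<cdot> (g \<cdot> k) = k"
        using Cmp_cancel_left[OF g f fg] by blast
      show "\<forall>k\<in>Hom \<C> D A. g \<cdot> (f \<cdot> k) = k"
        using Cmp_cancel_left[OF f g gf] by blast
      show "(\<lambda>k. g \<cdot> k) ` Hom \<C> D B \<subseteq> Hom \<C> D A"
        using Cmp_Hom[OF _ g] by blast
      show "(\<lambda>k. f \<cdot> k) ` Hom \<C> D A \<subseteq> Hom \<C> D B"
        using Cmp_Hom[OF _ f] by blast
    qed
    then show ?thesis by (rule bij_betw_same_card)
  qed
  then have "card (Hom \<C> D B) = card (Hom \<C> D A)" if "B \<in> iso_class \<C> A" for B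
    using that unfolding iso_rel_def by blast
  moreover have "A \<in> iso_class \<C> A"
    using assms isomorphic_refl by (auto simp: iso_rel_def)
  ultimately have "(\<lambda>B. card (Hom \<C> D B)) ` iso_class \<C> A = {card (Hom \<C> D A)}"
    by blast
  then show ?thesis by (simp add: hom_count_def)
qed

end

end

theory Submission
  imports Defs
begin

text \<open>In a locally finite extensive category every object decomposes into finitely many connected
  ones: a decomposition \<open>Y = Y\<^sub>1 + Y\<^sub>2\<close> of an object over \<open>X\<close> into non-initial summands gives
  \<open>#Hom(Y, X + X) = #Hom(Y\<^sub>1, X + X) \<cdot> #Hom(Y\<^sub>2, X + X)\<close> with both factors at least 2, because the
  two coprojections of \<open>X + X\<close> are disjoint; so splitting terminates. Hence the numbers
  \<open>#Hom(C, A)\<close> for \<open>C\<close> connected determine \<open>#Hom(Y, A)\<close> for all \<open>Y\<close>, and with it the class of \<open>A\<close>.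
  That \<open>Dec\<close> is a commutative monoid, respectively semi-ring, need not be known beforehand: its
  operations are closed and mapped injectively to those of a power of \<open>\<nat>\<close>, so all equational laws
  are inherited, distributivity included.\<close>

section \<open>Structures embedded in commutative monoids and semi-rings\<close>

text \<open>Under \<open>h\<close> each equation to be proved becomes an instance of the same law in
  \<open>N\<close>, and injectivity pulls it back; only closure has to be known in \<open>M\<close>
  itself.\<close>

lemma comm_monoid_of_inj_hom:
  fixes M (structure) and N (structure)
  assumes N: "comm_monoid N" and h: "h \<in> hom M N" "h \<one>\<^bsub>M\<^esub> = \<one>\<^bsub>N\<^esub>"
    and inj: "inj_on h (carrier M)"
    and closed: "\<And>x y. \<lbrakk>x \<in> carrier M; y \<in> carrier M\<rbrakk> \<Longrightarrow> x \<otimes>\<^bsub>M\<^esub> y \<in> carrier M"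
      "\<one>\<^bsub>M\<^esub> \<in> carrier M"
  shows "comm_monoid M"
proof -
  interpret N: comm_monoid N by (rule N)
  have car: "h x \<in> carrier N" if "x \<in> carrier M" for x
    using h(1) that by (rule hom_in_carrier)
  have mult: "h (x \<otimes>\<^bsub>M\<^esub> y) = h x \<otimes>\<^bsub>N\<^esub> h y" if "x \<in> carrier M" "y \<in> carrier M" for x y
    using h(1) that by (rule hom_mult)
  show ?thesis
    \<comment> \<open>The optional rule passes to images in the goals that are equations; the two
      closure goals are left as they are.\<close>
    by (rule comm_monoidI; (rule inj_onD[OF inj])?)
      (simp_all add: closed mult car h(2) N.m_ac)
qed

text \<open>The transfer to the image is done for the multiplicative monoid, then for
  \<open>add_monoid R\<close>, and finally for the distributive and annihilation laws.\<close>

lemma comm_semiring_of_inj_hom: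
  fixes R (structure) and S (structure)
  assumes S: "comm_semiring S" and h: "h \<in> ring_hom R S" "h \<zero>\<^bsub>R\<^esub> = \<zero>\<^bsub>S\<^esub>"
    and inj: "inj_on h (carrier R)"
    and closed: "\<And>x y. \<lbrakk>x \<in> carrier R; y \<in> carrier R\<rbrakk> \<Longrightarrow> x \<otimes>\<^bsub>R\<^esub> y \<in> carrier R"
      "\<And>x y. \<lbrakk>x \<in> carrier R; y \<in> carrier R\<rbrakk> \<Longrightarrow> x \<oplus>\<^bsub>R\<^esub> y \<in> carrier R"
      "\<one>\<^bsub>R\<^esub> \<in> carrier R" "\<zero>\<^bsub>R\<^esub> \<in> carrier R"
  shows "comm_semiring R"
proof -
  interpret S: semiring S using S by (simp add: comm_semiring_def)
  have mult_S: "comm_monoid S" using S by (simp add: comm_semiring_def)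
  have mult_R: "comm_monoid R"
    using h(1) by (intro comm_monoid_of_inj_hom[OF mult_S _ _ inj] closed)
      (auto simp: ring_hom_def hom_def)
  have add_R: "comm_monoid (add_monoid R)"
    using h closed inj
    by (intro comm_monoid_of_inj_hom[OF S.a_comm_monoid, where h = h])
      (auto simp: ring_hom_def hom_def)
  have car: "h x \<in> carrier S" if "x \<in> carrier R" for x
    using h(1) that by (rule ring_hom_closed)
  have mult: "h (x \<otimes>\<^bsub>R\<^esub> y) = h x \<otimes>\<^bsub>S\<^esub> h y" if "x \<in> carrier R" "y \<in> carrier R" for x y
    using h(1) that by (rule ring_hom_mult)
  have add: "h (x \<oplus>\<^bsub>R\<^esub> y) = h x \<oplus>\<^bsub>S\<^esub> h y" if "x \<in> carrier R" "y \<in> carrier R" for x y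
    using h(1) that by (rule ring_hom_add)
  have "semiring_axioms R"
    by (rule semiring_axioms.intro; rule inj_onD[OF inj])
      (simp_all add: closed mult add car h(2) S.l_distr S.r_distr)
  then show ?thesis
    using mult_R add_R
    by (simp add: comm_semiring_def semiring_def abelian_monoid_def comm_monoid_def)
qed

section \<open>Powers of the natural numbers\<close>

lemma comm_monoid_nat_power: "comm_monoid (product_group I (\<lambda>_. nat_monoid))"
  by (rule comm_monoidI) (auto simp: product_group_def nat_monoid_def PiE_def extensional_def
      restrict_def fun_eq_iff)

lemma comm_semiring_nat_power: "comm_semiring (product_semiring I (\<lambda>_. nat_semiring))"
proof -
  let ?R = "product_semiring I (\<lambda>_. nat_semiring)"
  note defs = product_semiring_def nat_semiring_def PiE_def extensional_def restrict_def
    fun_eq_iff algebra_simps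
  have "comm_monoid ?R" by (rule comm_monoidI) (auto simp: defs)
  moreover have "abelian_monoid ?R" by (rule abelian_monoidI) (auto simp: defs)
  moreover have "semiring_axioms ?R" by (rule semiring_axioms.intro) (auto simp: defs)
  ultimately show ?thesis by (simp add: comm_semiring_def semiring_def comm_monoid_def)
qed


section \<open>Coproducts and hom-sets\<close>

context category
begin

section \<open>Universal properties of coproducts and initial objects\<close>

lemma coproduct_sym: "is_coproduct \<C> A B S i j \<Longrightarrow> is_coproduct \<C> B A S j i"
  unfolding is_coproduct_def by (metis (no_types, lifting))

lemma coproduct_arrows:
  assumes "is_coproduct \<C> A B S i j"
  shows "A \<in> Obj \<C>" "B \<in> Obj \<C>" "S \<in> Obj \<C>" "i \<in> Hom \<C> A S" "j \<in> Hom \<C> B S"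
  using assms by (auto simp: is_coproduct_def)

lemma coproduct_ex:
  assumes "is_coproduct \<C> A B S i j" "f \<in> Hom \<C> A X" "g \<in> Hom \<C> B X"
  obtains u where "u \<in> Hom \<C> S X" "u \<cdot> i = f" "u \<cdot> j = g"
proof -
  have "X \<in> Obj \<C>" using assms(2) Hom_Obj by blast
  then show ?thesis using assms that unfolding is_coproduct_def by blast
qed

lemma coproduct_eqI:
  assumes S: "is_coproduct \<C> A B S i j" and u: "u \<in> Hom \<C> S X" and v: "v \<in> Hom \<C> S X"
    and "u \<cdot> i = v \<cdot> i" "u \<cdot> j = v \<cdot> j"
  shows "u = v"
proof -
  have "X \<in> Obj \<C>" "v \<cdot> i \<in> Hom \<C> A X" "v \<cdot> j \<in> Hom \<C> B X"
    using Hom_Obj[OF v] Cmp_Hom[OF _ v] coproduct_arrows[OF S] by auto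
  then have "\<exists>!w. w \<in> Hom \<C> S X \<and> w \<cdot> i = v \<cdot> i \<and> w \<cdot> j = v \<cdot> j"
    using S unfolding is_coproduct_def by blast
  with assms show ?thesis by blast
qed

lemma initial_ex:
  assumes "is_initial \<C> Z" "X \<in> Obj \<C>"
  obtains z where "z \<in> Hom \<C> Z X"
  using assms unfolding is_initial_def by blast

lemma initial_eqI:
  assumes "is_initial \<C> Z" "f \<in> Hom \<C> Z X" "g \<in> Hom \<C> Z X"
  shows "f = g"
  using assms Hom_Obj[OF assms(2)] unfolding is_initial_def by blast

text \<open>The first coprojection being an identity forces the copairing to be \<open>f\<close>,
  and the condition on \<open>Z\<close> then holds because arrows out of \<open>Z\<close> are
  unique. This supplies the degenerate rows to which extensivity is applied below.\<close>

lemma coproduct_initial: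
  assumes Z: "is_initial \<C> Z" and z: "z \<in> Hom \<C> Z A"
  shows "is_coproduct \<C> A Z A (Idn \<C> A) z"
proof -
  have "A \<in> Obj \<C>" "Z \<in> Obj \<C>" using Hom_Obj[OF z] by auto
  moreover have "\<exists>!u. u \<in> Hom \<C> A X \<and> u \<cdot> Idn \<C> A = f \<and> u \<cdot> z = g"
    if "f \<in> Hom \<C> A X" "g \<in> Hom \<C> Z X" for X f g
  proof (rule ex1I[of _ f])
    show "f \<in> Hom \<C> A X \<and> f \<cdot> Idn \<C> A = f \<and> f \<cdot> z = g"
      using that Idn_right initial_eqI[OF Z Cmp_Hom[OF z]] by blast
  qed (use Idn_right in force)
  ultimately show ?thesis using z Idn_Hom by (simp add: is_coproduct_def)
qed

text \<open>Copairing \<open>Z \<rightarrow> B\<close> with the identity of \<open>B\<close> gives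
  \<open>u\<close>; the composite \<open>j \<cdot> u\<close> agrees with the identity of
  \<open>S\<close> on both summands. Arrows out of \<open>S\<close> can thus be recovered from their
  restriction to \<open>B\<close>.\<close>

lemma coproduct_initial_section:
  assumes S: "is_coproduct \<C> Z B S i j" and Z: "is_initial \<C> Z"
  obtains u where "u \<in> Hom \<C> S B" "j \<cdot> u = Idn \<C> S"
proof -
  note ar = coproduct_arrows[OF S]
  obtain z where z: "z \<in> Hom \<C> Z B" using initial_ex[OF Z ar(2)] .
  obtain u where u: "u \<in> Hom \<C> S B" "u \<cdot> i = z" "u \<cdot> j = Idn \<C> B"
    using coproduct_ex[OF S z Idn_Hom[OF ar(2)]] .
  have ju: "j \<cdot> u \<in> Hom \<C> S S" using Cmp_Hom[OF u(1) ar(5)] .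
  have idS: "Idn \<C> S \<in> Hom \<C> S S" using Idn_Hom[OF ar(3)] .
  have "(j \<cdot> u) \<cdot> j = Idn \<C> S \<cdot> j"
    using Cmp_assoc[OF ar(5) u(1) ar(5)] u(3) Idn_right[OF ar(5)] Idn_left[OF ar(5)] by simp
  moreover have "(j \<cdot> u) \<cdot> i = Idn \<C> S \<cdot> i"
    using initial_eqI[OF Z Cmp_Hom[OF ar(4) ju] Cmp_Hom[OF ar(4) idS]] .
  ultimately have "j \<cdot> u = Idn \<C> S" using coproduct_eqI[OF S ju idS] by blast
  with u(1) show ?thesis by (rule that)
qed

section \<open>Cardinalities of hom-sets\<close>

lemma card_Hom_coproduct:
  assumes S: "is_coproduct \<C> A B S i j"
  shows "card (Hom \<C> S X) = card (Hom \<C> A X) * card (Hom \<C> B X)"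
proof -
  have "bij_betw (\<lambda>u. (u \<cdot> i, u \<cdot> j)) (Hom \<C> S X) (Hom \<C> A X \<times> Hom \<C> B X)"
  proof (rule bij_betw_imageI)
    show "inj_on (\<lambda>u. (u \<cdot> i, u \<cdot> j)) (Hom \<C> S X)"
      using coproduct_eqI[OF S] by (auto intro!: inj_onI)
    show "(\<lambda>u. (u \<cdot> i, u \<cdot> j)) ` Hom \<C> S X = Hom \<C> A X \<times> Hom \<C> B X"
    proof (intro equalityI subsetI)
      fix y assume "y \<in> Hom \<C> A X \<times> Hom \<C> B X"
      then show "y \<in> (\<lambda>u. (u \<cdot> i, u \<cdot> j)) ` Hom \<C> S X"
        by (elim SigmaE) (metis (no_types, lifting) coproduct_ex[OF S] image_eqI)
    qed (use coproduct_arrows[OF S] Cmp_Hom in auto)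
  qed
  then show ?thesis by (simp add: bij_betw_same_card card_cartesian_product)
qed

text \<open>This is \<open>card_Hom_coproduct\<close> read in the opposite category.\<close>

lemma card_Hom_product:
  assumes "is_product \<C> A B P p q"
  shows "card (Hom \<C> X P) = card (Hom \<C> X A) * card (Hom \<C> X B)"
  using category.card_Hom_coproduct[OF category_opposite] assms
  unfolding is_coproduct_opposite Hom_opposite by blast

text \<open>Invariance in the target is \<open>hom_count_class\<close>; the opposite category turns
  it into invariance in the source.\<close>

lemma card_Hom_cong:
  assumes "isomorphic \<C> X Y" "X \<in> Obj \<C>" "Y \<in> Obj \<C>"
  shows "card (Hom \<C> X A) = card (Hom \<C> Y A)"
proof -
  interpret op: category "opposite \<C>" by (rule category_opposite)
  have Obj: "Obj (opposite \<C>) = Obj \<C>" by (simp add: opposite_def)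
  have "iso_class (opposite \<C>) X = iso_class (opposite \<C>) Y"
    using assms by (intro equiv_class_eq[OF op.equiv_iso_rel])
      (simp add: iso_rel_def isomorphic_opposite Obj)
  then show ?thesis
    using op.hom_count_class[of X A] op.hom_count_class[of Y A] assms
    by (simp add: Hom_opposite Obj)
qed

lemma card_Hom_initial:
  assumes "is_initial \<C> Z" "X \<in> Obj \<C>"
  shows "card (Hom \<C> Z X) = 1"
proof -
  obtain f where "f \<in> Hom \<C> Z X" using initial_ex[OF assms] .
  then have "Hom \<C> Z X = {f}" using initial_eqI[OF assms(1)] by blast
  then show ?thesis by simp
qed

lemma card_Hom_terminal:
  assumes "is_terminal \<C> T" "X \<in> Obj \<C>"
  shows "card (Hom \<C> X T) = 1"
proof -
  have "is_initial (opposite \<C>) T"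
    using assms(1) by (simp add: is_initial_def is_terminal_def Hom_opposite) (simp add: opposite_def)
  moreover have "X \<in> Obj (opposite \<C>)" using assms(2) by (simp add: opposite_def)
  ultimately show ?thesis
    using category.card_Hom_initial[OF category_opposite] by (simp add: Hom_opposite)
qed

section \<open>Isomorphism classes and the chosen universal objects\<close>

lemma Dec_cases:
  assumes "X \<in> Dec \<C>"
  obtains A where "A \<in> Obj \<C>" "X = iso_class \<C> A"
  using assms unfolding Dec_def by (rule quotientE)

lemma is_coproduct_coprod_obj:
  assumes "has_finite_coproducts \<C>" "A \<in> Obj \<C>" "B \<in> Obj \<C>"
  obtains i j where "is_coproduct \<C> A B (coprod_obj \<C> A B) i j"
proof -
  have "\<exists>S i j. is_coproduct \<C> A B S i j"
    using assms by (simp add: has_finite_coproducts_def)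
  then have "\<exists>i j. is_coproduct \<C> A B (coprod_obj \<C> A B) i j"
    unfolding coprod_obj_def by (rule someI_ex)
  then show ?thesis using that by blast
qed

lemma is_product_prod_obj:
  assumes "has_finite_products \<C>" "A \<in> Obj \<C>" "B \<in> Obj \<C>"
  obtains p q where "is_product \<C> A B (prod_obj \<C> A B) p q"
proof -
  have "\<exists>P p q. is_product \<C> A B P p q"
    using assms by (simp add: has_finite_products_def)
  then have "\<exists>p q. is_product \<C> A B (prod_obj \<C> A B) p q"
    unfolding prod_obj_def by (rule someI_ex)
  then show ?thesis using that by blast
qed

lemma is_initial_initial_obj:
  assumes "has_finite_coproducts \<C>"
  shows "is_initial \<C> (initial_obj \<C>)"
  using assms unfolding has_finite_coproducts_def initial_obj_def by (metis someI_ex)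

lemma is_terminal_terminal_obj:
  assumes "has_finite_products \<C>"
  shows "is_terminal \<C> (terminal_obj \<C>)"
  using assms unfolding has_finite_products_def terminal_obj_def by (metis someI_ex)

end


section \<open>Extensive categories\<close>

locale extensive_category = category +
  assumes extensive: "extensive \<C>"
begin

section \<open>Extensivity in the form of rules\<close>

lemma finite_coproducts: "has_finite_coproducts \<C>"
  using extensive by (simp add: extensive_def)

lemma coproduct_iff_pullbacks:
  assumes "is_coproduct \<C> X1 X2 S i1 i2" "f \<in> Hom \<C> A S"
    "a1 \<in> Hom \<C> A1 A" "a2 \<in> Hom \<C> A2 A" "x1 \<in> Hom \<C> A1 X1" "x2 \<in> Hom \<C> A2 X2"
    "f \<cdot> a1 = i1 \<cdot> x1" "f \<cdot> a2 = i2 \<cdot> x2"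
  shows "is_coproduct \<C> A1 A2 A a1 a2 \<longleftrightarrow>
    is_pullback \<C> f i1 A1 a1 x1 \<and> is_pullback \<C> f i2 A2 a2 x2"
proof -
  have ext: "\<forall>X1 X2 S i1 i2 A f A1 A2 a1 a2 x1 x2.
        is_coproduct \<C> X1 X2 S i1 i2 \<longrightarrow> f \<in> Hom \<C> A S \<longrightarrow>
        a1 \<in> Hom \<C> A1 A \<longrightarrow> a2 \<in> Hom \<C> A2 A \<longrightarrow>
        x1 \<in> Hom \<C> A1 X1 \<longrightarrow> x2 \<in> Hom \<C> A2 X2 \<longrightarrow>
        f \<cdot> a1 = i1 \<cdot> x1 \<longrightarrow> f \<cdot> a2 = i2 \<cdot> x2 \<longrightarrow>
        (is_coproduct \<C> A1 A2 A a1 a2 \<longleftrightarrow>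
           is_pullback \<C> f i1 A1 a1 x1 \<and> is_pullback \<C> f i2 A2 a2 x2)"
    using extensive unfolding extensive_def by (elim conjE)
  show ?thesis
    by (rule ext[rule_format]) (fact assms)+
qed

lemma pullback_coprojection:
  assumes "is_coproduct \<C> X1 X2 S i1 i2" "f \<in> Hom \<C> A S"
  obtains P p q where "is_pullback \<C> f i1 P p q" "p \<in> Hom \<C> P A" "q \<in> Hom \<C> P X1"
    "f \<cdot> p = i1 \<cdot> q"
proof -
  have "\<exists>P p q. is_pullback \<C> f i1 P p q"
    using extensive assms unfolding extensive_def by blast
  then obtain P p q where P: "is_pullback \<C> f i1 P p q" by blast
  moreover have "Dom \<C> f = A" "Dom \<C> i1 = X1"
    using assms(2) coproduct_arrows(4)[OF assms(1)] by (auto simp: Hom_def)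
  ultimately show ?thesis using that[OF P] unfolding is_pullback_def by simp
qed

text \<open>Both coprojections are pulled back along \<open>f\<close>, the second after swapping the
  summands; extensivity makes the two pullbacks a coproduct diagram over \<open>A\<close>.\<close>

lemma coproduct_decompose:
  assumes S: "is_coproduct \<C> X1 X2 S i1 i2" and f: "f \<in> Hom \<C> A S"
  obtains A1 A2 a1 a2 x1 x2 where "is_coproduct \<C> A1 A2 A a1 a2"
    "x1 \<in> Hom \<C> A1 X1" "x2 \<in> Hom \<C> A2 X2" "f \<cdot> a1 = i1 \<cdot> x1" "f \<cdot> a2 = i2 \<cdot> x2"
proof -
  obtain A1 a1 x1 where 1: "is_pullback \<C> f i1 A1 a1 x1" "a1 \<in> Hom \<C> A1 A" "x1 \<in> Hom \<C> A1 X1"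
    "f \<cdot> a1 = i1 \<cdot> x1"
    using pullback_coprojection[OF S f] .
  obtain A2 a2 x2 where 2: "is_pullback \<C> f i2 A2 a2 x2" "a2 \<in> Hom \<C> A2 A" "x2 \<in> Hom \<C> A2 X2"
    "f \<cdot> a2 = i2 \<cdot> x2"
    using pullback_coprojection[OF coproduct_sym[OF S] f] .
  have "is_coproduct \<C> A1 A2 A a1 a2"
    using coproduct_iff_pullbacks[OF S f 1(2) 2(2) 1(3) 2(3) 1(4) 2(4)] 1(1) 2(1) by blast
  then show ?thesis using that 1 2 by blast
qed

text \<open>Pulling the row \<open>0 \<rightarrow> 0 \<leftarrow> 0\<close> back along \<open>f\<close> shows that \<open>Y \<rightarrow> Y \<leftarrow> Y\<close>, with identities, is a
  coproduct diagram, so parallel arrows out of \<open>Y\<close> are equal.\<close>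

lemma strict_initial:
  assumes Z: "is_initial \<C> Z" and f: "f \<in> Hom \<C> Y Z"
  shows "is_initial \<C> Y"
proof -
  have ZO: "Z \<in> Obj \<C>" and YO: "Y \<in> Obj \<C>" using Hom_Obj[OF f] by auto
  note idZ = Idn_Hom[OF ZO] and idY = Idn_Hom[OF YO]
  have sq: "f \<cdot> Idn \<C> Y = Idn \<C> Z \<cdot> f"
    using Idn_left[OF f] Idn_right[OF f] by simp
  have "Dom \<C> f = Y" "Cod \<C> f = Z" "f \<in> Arr \<C>"
    and "Dom \<C> (Idn \<C> Z) = Z" "Cod \<C> (Idn \<C> Z) = Z" "Idn \<C> Z \<in> Arr \<C>"
    using f idZ by (auto simp: Hom_def)
  moreover have "\<exists>!u. u \<in> Hom \<C> X Y \<and> Idn \<C> Y \<cdot> u = s \<and> f \<cdot> u = t"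
    if "s \<in> Hom \<C> X Y" "t \<in> Hom \<C> X Z" "f \<cdot> s = Idn \<C> Z \<cdot> t" for X s t
    using that Idn_left by (intro ex1I[of _ s]) force+
  ultimately have pb: "is_pullback \<C> f (Idn \<C> Z) Y (Idn \<C> Y) f"
    using YO idY f sq by (simp add: is_pullback_def)
  have ZZ: "is_coproduct \<C> Z Z Z (Idn \<C> Z) (Idn \<C> Z)"
    using coproduct_initial[OF Z idZ] .
  have YY: "is_coproduct \<C> Y Y Y (Idn \<C> Y) (Idn \<C> Y)"
    using coproduct_iff_pullbacks[OF ZZ f idY idY f f sq sq] pb by blast
  have "\<exists>!g. g \<in> Hom \<C> Y X" if X: "X \<in> Obj \<C>" for X
  proof -
    obtain z where z: "z \<in> Hom \<C> Z X" using initial_ex[OF Z X] .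
    have "g = h" if g: "g \<in> Hom \<C> Y X" and h: "h \<in> Hom \<C> Y X" for g h
    proof -
      obtain u where "u \<in> Hom \<C> Y X" "u \<cdot> Idn \<C> Y = g" "u \<cdot> Idn \<C> Y = h"
        using coproduct_ex[OF YY g h] .
      then show ?thesis by simp
    qed
    with Cmp_Hom[OF f z] show ?thesis by blast
  qed
  with YO show ?thesis by (simp add: is_initial_def)
qed

text \<open>The row \<open>X1 \<rightarrow> X1 \<leftarrow> Z\<close> is a coproduct diagram lying
  over \<open>S\<close> by means of \<open>i1\<close>, so extensivity makes both of its squares
  pullbacks. The first says that \<open>i1\<close> is monic, the second that the coprojections are
  disjoint.\<close>

lemma coprojection_pullbacks:
  assumes S: "is_coproduct \<C> X1 X2 S i1 i2" and Z: "is_initial \<C> Z"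
    and z1: "z1 \<in> Hom \<C> Z X1" and z2: "z2 \<in> Hom \<C> Z X2"
  shows "is_pullback \<C> i1 i1 X1 (Idn \<C> X1) (Idn \<C> X1)" "is_pullback \<C> i1 i2 Z z1 z2"
proof -
  note ar = coproduct_arrows[OF S]
  have "i1 \<cdot> z1 = i2 \<cdot> z2"
    using initial_eqI[OF Z Cmp_Hom[OF z1 ar(4)] Cmp_Hom[OF z2 ar(5)]] .
  from coproduct_iff_pullbacks[OF S ar(4) Idn_Hom[OF ar(1)] z1 Idn_Hom[OF ar(1)] z2 refl this]
    coproduct_initial[OF Z z1]
  show "is_pullback \<C> i1 i1 X1 (Idn \<C> X1) (Idn \<C> X1)" "is_pullback \<C> i1 i2 Z z1 z2" by auto
qed

text \<open>The kernel pair of \<open>i1\<close> consists of identities, so \<open>s\<close> and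
  \<open>t\<close> both equal the arrow that they induce into it.\<close>

lemma coprojection_mono:
  assumes S: "is_coproduct \<C> X1 X2 S i1 i2" and s: "s \<in> Hom \<C> Y X1" and t: "t \<in> Hom \<C> Y X1"
    and eq: "i1 \<cdot> s = i1 \<cdot> t"
  shows "s = t"
proof -
  note ar = coproduct_arrows[OF S]
  have Z: "is_initial \<C> (initial_obj \<C>)" using is_initial_initial_obj[OF finite_coproducts] .
  obtain z1 where z1: "z1 \<in> Hom \<C> (initial_obj \<C>) X1" using initial_ex[OF Z ar(1)] .
  obtain z2 where z2: "z2 \<in> Hom \<C> (initial_obj \<C>) X2" using initial_ex[OF Z ar(2)] .
  have "Dom \<C> i1 = X1" "Y \<in> Obj \<C>" using ar(4) Hom_Obj[OF s] by (auto simp: Hom_def)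
  with coprojection_pullbacks(1)[OF S Z z1 z2] s t eq
  obtain u where "u \<in> Hom \<C> Y X1" "Idn \<C> X1 \<cdot> u = s" "Idn \<C> X1 \<cdot> u = t"
    unfolding is_pullback_def by metis
  then show ?thesis by simp
qed

text \<open>Since the initial object is the pullback of \<open>i1\<close> and \<open>i2\<close>, the
  pair \<open>s\<close>, \<open>t\<close> induces an arrow from \<open>Y\<close> to it, and initial
  objects are strict.\<close>

lemma coprojection_disjoint:
  assumes S: "is_coproduct \<C> X1 X2 S i1 i2" and s: "s \<in> Hom \<C> Y X1" and t: "t \<in> Hom \<C> Y X2"
    and eq: "i1 \<cdot> s = i2 \<cdot> t"
  shows "is_initial \<C> Y"
proof -
  note ar = coproduct_arrows[OF S]
  have Z: "is_initial \<C> (initial_obj \<C>)" using is_initial_initial_obj[OF finite_coproducts] .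
  obtain z1 where z1: "z1 \<in> Hom \<C> (initial_obj \<C>) X1" using initial_ex[OF Z ar(1)] .
  obtain z2 where z2: "z2 \<in> Hom \<C> (initial_obj \<C>) X2" using initial_ex[OF Z ar(2)] .
  have "Dom \<C> i1 = X1" "Dom \<C> i2 = X2" "Y \<in> Obj \<C>"
    using ar(4,5) Hom_Obj[OF s] by (auto simp: Hom_def)
  with coprojection_pullbacks(2)[OF S Z z1 z2] s t eq
  obtain u where "u \<in> Hom \<C> Y (initial_obj \<C>)"
    unfolding is_pullback_def by metis
  with Z show ?thesis by (rule strict_initial)
qed

text \<open>For non-initial \<open>Y\<close> the comparison map is always injective, so if
  \<open>Y\<close> is not connected, some \<open>f\<close> into a coproduct factors through neither
  coprojection. Decomposing \<open>Y\<close> along \<open>f\<close> gives the summands: were one of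
  them initial, \<open>f\<close> would factor through the coprojection belonging to the
  other.\<close>

lemma not_connected_split:
  assumes Y: "Y \<in> Obj \<C>" and ni: "\<not> is_initial \<C> Y" and nc: "\<not> connected_obj \<C> Y"
  obtains Y1 Y2 y1 y2 where "is_coproduct \<C> Y1 Y2 Y y1 y2"
    "\<not> is_initial \<C> Y1" "\<not> is_initial \<C> Y2"
proof -
  obtain A B S i j where S: "is_coproduct \<C> A B S i j"
    and nb: "\<not> bij_betw (case_sum (\<lambda>f. i \<cdot> f) (\<lambda>g. j \<cdot> g)) (Hom \<C> Y A <+> Hom \<C> Y B) (Hom \<C> Y S)"
    using Y nc unfolding connected_obj_def by blast
  note ar = coproduct_arrows[OF S]
  let ?h = "case_sum (\<lambda>f. i \<cdot> f) (\<lambda>g. j \<cdot> g)"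
  have "inj_on ?h (Hom \<C> Y A <+> Hom \<C> Y B)"
  proof (rule inj_onI)
    fix s t assume "s \<in> Hom \<C> Y A <+> Hom \<C> Y B" "t \<in> Hom \<C> Y A <+> Hom \<C> Y B" "?h s = ?h t"
    \<comment> \<open>Two arrows on the same side agree because coprojections are monic; on
      different sides, equal images would make \<open>Y\<close> initial.\<close>
    then show "s = t"
      using coprojection_mono[OF S] coprojection_mono[OF coproduct_sym[OF S]]
        coprojection_disjoint[OF S, of _ Y] ni
      by (elim PlusE) (auto, metis)
  qed
  moreover have "?h ` (Hom \<C> Y A <+> Hom \<C> Y B) \<subseteq> Hom \<C> Y S"
    using Cmp_Hom ar by (auto elim!: PlusE)
  ultimately obtain f where f: "f \<in> Hom \<C> Y S" and nf: "f \<notin> ?h ` (Hom \<C> Y A <+> Hom \<C> Y B)"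
    using nb unfolding bij_betw_def by blast
  have nA: "f \<noteq> i \<cdot> g" if "g \<in> Hom \<C> Y A" for g
    using nf that by (metis InlI image_eqI old.sum.simps(5))
  have nB: "f \<noteq> j \<cdot> g" if "g \<in> Hom \<C> Y B" for g
    using nf that by (metis InrI image_eqI old.sum.simps(6))
  \<comment> \<open>Here \<open>B\<close> and \<open>j\<close> are generalised, so that the claim
    serves for either summand. If \<open>Y1\<close> is initial then \<open>y2\<close> has a right
    inverse \<open>u\<close>, and \<open>f\<close> equals
    \<open>f \<cdot> y2 \<cdot> u\<close>.\<close>
  have factor: "\<exists>g\<in>Hom \<C> Y B. f = j \<cdot> g"
    if Y12: "is_coproduct \<C> Y1 Y2 Y y1 y2" and ini: "is_initial \<C> Y1"
      and x: "x \<in> Hom \<C> Y2 B" "f \<cdot> y2 = j \<cdot> x" and j: "j \<in> Hom \<C> B S"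
    for Y1 Y2 y1 y2 x B j
  proof -
    have y2: "y2 \<in> Hom \<C> Y2 Y" using coproduct_arrows[OF Y12] by simp
    obtain u where u: "u \<in> Hom \<C> Y Y2" "y2 \<cdot> u = Idn \<C> Y"
      using coproduct_initial_section[OF Y12 ini] .
    have "f = f \<cdot> (y2 \<cdot> u)" using Idn_right[OF f] u(2) by simp
    also have "\<dots> = j \<cdot> (x \<cdot> u)"
      using Cmp_assoc[OF u(1) y2 f] Cmp_assoc[OF u(1) x(1) j] x(2) by simp
    finally show ?thesis using Cmp_Hom[OF u(1) x(1)] by blast
  qed
  obtain Y1 Y2 y1 y2 x1 x2 where Y12: "is_coproduct \<C> Y1 Y2 Y y1 y2"
    and x: "x1 \<in> Hom \<C> Y1 A" "x2 \<in> Hom \<C> Y2 B" "f \<cdot> y1 = i \<cdot> x1" "f \<cdot> y2 = j \<cdot> x2"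
    using coproduct_decompose[OF S f] .
  have "\<not> is_initial \<C> Y1"
    using factor[OF Y12 _ x(2,4) ar(5)] nB by blast
  moreover have "\<not> is_initial \<C> Y2"
    using factor[OF coproduct_sym[OF Y12] _ x(1,3) ar(4)] nA by blast
  ultimately show ?thesis using that[OF Y12] by blast
qed

end


section \<open>Counting arrows out of connected objects\<close>

locale locally_finite_extensive_category = extensive_category +
  assumes locally_finite: "locally_finite \<C>"
begin

lemma finite_Hom: "finite (Hom \<C> A B)"
proof (cases "Hom \<C> A B = {}")
  case False
  then have "A \<in> Obj \<C>" "B \<in> Obj \<C>" using Hom_Obj by blast+
  then show ?thesis using locally_finite by (simp add: locally_finite_def)
qed simp

text \<open>Local finiteness turns the bijection with a disjoint sum into an equation of natural
  numbers.\<close>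

lemma card_Hom_connected_coproduct:
  assumes "connected_obj \<C> D" "is_coproduct \<C> A B S i j"
  shows "card (Hom \<C> D S) = card (Hom \<C> D A) + card (Hom \<C> D B)"
proof -
  have "bij_betw (case_sum (\<lambda>f. i \<cdot> f) (\<lambda>g. j \<cdot> g)) (Hom \<C> D A <+> Hom \<C> D B) (Hom \<C> D S)"
    using assms unfolding connected_obj_def by blast
  from bij_betw_same_card[OF this] show ?thesis by (simp add: card_Plus finite_Hom)
qed

text \<open>As \<open>Z\<close> is a coproduct of \<open>Z\<close> with itself, the count
  \<open>n\<close> satisfies \<open>n = n + n\<close>.\<close>

lemma card_Hom_connected_initial:
  assumes D: "connected_obj \<C> D" and Z: "is_initial \<C> Z"
  shows "card (Hom \<C> D Z) = 0"
proof -
  have "Z \<in> Obj \<C>" using Z by (simp add: is_initial_def)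
  from card_Hom_connected_coproduct[OF D coproduct_initial[OF Z Idn_Hom[OF this]]]
  show ?thesis by simp
qed

text \<open>Composing \<open>y\<close> with the two coprojections gives two arrows, distinct by
  disjointness.\<close>

lemma two_le_card_Hom_coproduct:
  assumes S: "is_coproduct \<C> X X S i j" and y: "y \<in> Hom \<C> Y X" and ni: "\<not> is_initial \<C> Y"
  shows "2 \<le> card (Hom \<C> Y S)"
proof -
  have "i \<cdot> y \<noteq> j \<cdot> y" using coprojection_disjoint[OF S y y] ni by blast
  then have "card {i \<cdot> y, j \<cdot> y} = 2" by simp
  moreover have "{i \<cdot> y, j \<cdot> y} \<subseteq> Hom \<C> Y S"
    using coproduct_arrows[OF S] Cmp_Hom[OF y] by blast
  ultimately show ?thesis using card_mono[OF finite_Hom] by metis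
qed

lemma connected_Hom_counts_determine_all:
  assumes conn: "\<And>D. connected_obj \<C> D \<Longrightarrow> card (Hom \<C> D A) = card (Hom \<C> D B)"
    and A: "A \<in> Obj \<C>" and B: "B \<in> Obj \<C>" and X: "X \<in> Obj \<C>"
  shows "card (Hom \<C> X A) = card (Hom \<C> X B)"
proof -
  obtain i j where S: "is_coproduct \<C> X X (coprod_obj \<C> X X) i j" (is "is_coproduct _ _ _ ?S _ _")
    using is_coproduct_coprod_obj[OF finite_coproducts X X] .
  \<comment> \<open>The claim is generalised to all objects over \<open>X\<close>: this class
    contains the summands of its members, and the arrow to \<open>X\<close> is what gives each
    non-initial member at least two arrows to \<open>?S\<close>.\<close>
  have "card (Hom \<C> Y A) = card (Hom \<C> Y B)" if "y \<in> Hom \<C> Y X" for Y y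
    using that
  proof (induction "card (Hom \<C> Y ?S)" arbitrary: Y y rule: less_induct)
    case less
    have Y: "Y \<in> Obj \<C>" using Hom_Obj[OF less.prems] by simp
    consider "is_initial \<C> Y" | "connected_obj \<C> Y" | "\<not> is_initial \<C> Y" "\<not> connected_obj \<C> Y"
      by blast
    then show ?case
    proof cases
      case 1
      then show ?thesis using card_Hom_initial A B by simp
    next
      case 2
      then show ?thesis by (rule conn)
    next
      case 3
      obtain Y1 Y2 y1 y2 where Y12: "is_coproduct \<C> Y1 Y2 Y y1 y2"
        and ni: "\<not> is_initial \<C> Y1" "\<not> is_initial \<C> Y2"
        using not_connected_split[OF Y 3] .
      have y: "y \<cdot> y1 \<in> Hom \<C> Y1 X" "y \<cdot> y2 \<in> Hom \<C> Y2 X"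
        using coproduct_arrows[OF Y12] Cmp_Hom[OF _ less.prems] by auto
      have ge: "2 \<le> card (Hom \<C> Y1 ?S)" "2 \<le> card (Hom \<C> Y2 ?S)"
        using two_le_card_Hom_coproduct[OF S] y ni by blast+
      \<comment> \<open>A product of two numbers that are at least 2 exceeds each of them.\<close>
      have "card (Hom \<C> Y1 ?S) < card (Hom \<C> Y ?S)" "card (Hom \<C> Y2 ?S) < card (Hom \<C> Y ?S)"
        unfolding card_Hom_coproduct[OF Y12] using ge by simp_all
      from less.hyps[OF this(1) y(1)] less.hyps[OF this(2) y(2)] show ?thesis
        by (simp add: card_Hom_coproduct[OF Y12])
    qed
  qed
  from this[OF Idn_Hom[OF X]] show ?thesis .
qed

end


section \<open>The embedding of \<open>Dec\<close>\<close>

text \<open>The type \<open>'a\<close> is that of the objects of \<open>\<C>\<close>.\<close>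

locale combinatorial_extensive_category = locally_finite_extensive_category +
  fixes I :: "'i set" and K :: "'i \<Rightarrow> 'a"
  assumes combinatorial: "combinatorial \<C>"
    and representatives: "connected_representatives \<C> I K"
begin

lemma connected_K: "i \<in> I \<Longrightarrow> connected_obj \<C> (K i)"
  using representatives by (simp add: connected_representatives_def)

lemma hom_counts_class:
  assumes "A \<in> Obj \<C>"
  shows "hom_counts \<C> I K (iso_class \<C> A) = (\<lambda>i\<in>I. card (Hom \<C> (K i) A))"
  using assms by (simp add: hom_counts_def iso_class_in_Dec hom_count_class)

text \<open>Equal counts at the representatives extend to all connected objects by isomorphism
  invariance and then to all objects by decomposition, so that \<open>combinatorial\<close>
  applies.\<close>

lemma inj_on_hom_counts: "inj_on (hom_counts \<C> I K) (Dec \<C>)"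
proof (rule inj_onI)
  fix X Y assume "X \<in> Dec \<C>" "Y \<in> Dec \<C>" and eq: "hom_counts \<C> I K X = hom_counts \<C> I K Y"
  obtain A where A: "A \<in> Obj \<C>" "X = iso_class \<C> A" using Dec_cases[OF \<open>X \<in> Dec \<C>\<close>] .
  obtain B where B: "B \<in> Obj \<C>" "Y = iso_class \<C> B" using Dec_cases[OF \<open>Y \<in> Dec \<C>\<close>] .
  have eqK: "card (Hom \<C> (K i) A) = card (Hom \<C> (K i) B)" if "i \<in> I" for i
    using fun_cong[OF eq, of i] that A B by (simp add: hom_counts_class)
  have "card (Hom \<C> D A) = card (Hom \<C> D B)" if D: "connected_obj \<C> D" for D
  proof -
    obtain i where i: "i \<in> I" "isomorphic \<C> D (K i)"
      using representatives D unfolding connected_representatives_def by blast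
    have "D \<in> Obj \<C>" "K i \<in> Obj \<C>"
      using D connected_K[OF i(1)] by (simp_all add: connected_obj_def)
    with i eqK show ?thesis using card_Hom_cong by metis
  qed
  then have "\<forall>X\<in>Obj \<C>. card (Hom \<C> X A) = card (Hom \<C> X B)"
    using connected_Hom_counts_determine_all A(1) B(1) by blast
  then have "isomorphic \<C> A B"
    using combinatorial A(1) B(1) by (simp add: combinatorial_def)
  then show "X = Y"
    unfolding A(2) B(2) using A(1) B(1)
    by (intro equiv_class_eq[OF equiv_iso_rel]) (simp add: iso_rel_def)
qed

section \<open>Addition of isomorphism classes\<close>

lemma Dec_add_closed:
  assumes "X \<in> Dec \<C>" "Y \<in> Dec \<C>"
  shows "Dec_add \<C> X Y \<in> Dec \<C>"
proof -
  obtain A where A: "A \<in> Obj \<C>" "X = iso_class \<C> A" using Dec_cases[OF assms(1)] .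
  obtain B where B: "B \<in> Obj \<C>" "Y = iso_class \<C> B" using Dec_cases[OF assms(2)] .
  obtain i j where "is_coproduct \<C> A B (coprod_obj \<C> A B) i j"
    using is_coproduct_coprod_obj[OF finite_coproducts A(1) B(1)] .
  then have "coprod_obj \<C> A B \<in> Obj \<C>" by (rule coproduct_arrows)
  then show ?thesis using A B by (simp add: Dec_add_class[OF finite_coproducts] iso_class_in_Dec)
qed

text \<open>Connectedness of each \<open>K i\<close> makes its hom-count additive on the chosen
  coproduct.\<close>

lemma hom_counts_add:
  assumes "X \<in> Dec \<C>" "Y \<in> Dec \<C>"
  shows "hom_counts \<C> I K (Dec_add \<C> X Y) =
    (\<lambda>i\<in>I. hom_counts \<C> I K X i + hom_counts \<C> I K Y i)"
proof -
  obtain A where A: "A \<in> Obj \<C>" "X = iso_class \<C> A" using Dec_cases[OF assms(1)] .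
  obtain B where B: "B \<in> Obj \<C>" "Y = iso_class \<C> B" using Dec_cases[OF assms(2)] .
  obtain i j where S: "is_coproduct \<C> A B (coprod_obj \<C> A B) i j"
    using is_coproduct_coprod_obj[OF finite_coproducts A(1) B(1)] .
  show ?thesis
    using A B coproduct_arrows(3)[OF S] card_Hom_connected_coproduct[OF connected_K S]
    by (simp add: Dec_add_class[OF finite_coproducts] hom_counts_class cong: restrict_cong)
qed

lemma hom_counts_initial:
  shows "iso_class \<C> (initial_obj \<C>) \<in> Dec \<C>"
    and "hom_counts \<C> I K (iso_class \<C> (initial_obj \<C>)) = (\<lambda>i\<in>I. 0)"
proof -
  have Z: "is_initial \<C> (initial_obj \<C>)" using is_initial_initial_obj[OF finite_coproducts] .
  then have ZO: "initial_obj \<C> \<in> Obj \<C>" by (simp add: is_initial_def)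
  show "iso_class \<C> (initial_obj \<C>) \<in> Dec \<C>" using ZO by (rule iso_class_in_Dec)
  show "hom_counts \<C> I K (iso_class \<C> (initial_obj \<C>)) = (\<lambda>i\<in>I. 0)"
    unfolding hom_counts_class[OF ZO]
    using card_Hom_connected_initial[OF connected_K Z] by (simp cong: restrict_cong)
qed

text \<open>Restricting the values to \<open>I\<close> makes them extensional, as the carrier of the
  product demands.\<close>

lemma hom_counts_PiE: "X \<in> Dec \<C> \<Longrightarrow> hom_counts \<C> I K X \<in> (\<Pi>\<^sub>E i\<in>I. UNIV)"
  by (simp add: hom_counts_def)

lemma monoid_morphism_hom_counts:
  "monoid_morphism (Dec_monoid \<C>) (product_group I (\<lambda>_. nat_monoid)) (hom_counts \<C> I K)"
proof -
  let ?N = "product_group I (\<lambda>_. nat_monoid)"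
  have h: "hom_counts \<C> I K \<in> hom (Dec_monoid \<C>) ?N"
    using hom_counts_PiE
    by (auto simp: hom_def Dec_monoid_def product_group_def nat_monoid_def hom_counts_add)
  have one: "hom_counts \<C> I K \<one>\<^bsub>Dec_monoid \<C>\<^esub> = \<one>\<^bsub>?N\<^esub>"
    by (simp add: Dec_monoid_def product_group_def nat_monoid_def hom_counts_initial)
  \<comment> \<open>The monoid laws on classes are pulled back along the injective map just shown to
    preserve the operations.\<close>
  have "comm_monoid (Dec_monoid \<C>)"
    by (rule comm_monoid_of_inj_hom[OF comm_monoid_nat_power h one])
      (simp_all add: Dec_monoid_def inj_on_hom_counts Dec_add_closed hom_counts_initial)
  with h one show ?thesis by (simp add: monoid_morphism_def comm_monoid_nat_power)
qed

section \<open>Multiplication of isomorphism classes\<close>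

context
  assumes products: "has_finite_products \<C>"
begin

lemma Dec_mult_closed:
  assumes "X \<in> Dec \<C>" "Y \<in> Dec \<C>"
  shows "Dec_mult \<C> X Y \<in> Dec \<C>"
proof -
  obtain A where A: "A \<in> Obj \<C>" "X = iso_class \<C> A" using Dec_cases[OF assms(1)] .
  obtain B where B: "B \<in> Obj \<C>" "Y = iso_class \<C> B" using Dec_cases[OF assms(2)] .
  obtain p q where "is_product \<C> A B (prod_obj \<C> A B) p q"
    using is_product_prod_obj[OF products A(1) B(1)] .
  then have "prod_obj \<C> A B \<in> Obj \<C>" by (simp add: is_product_def)
  then show ?thesis using A B by (simp add: Dec_mult_class[OF products] iso_class_in_Dec)
qed

text \<open>Arrows from \<open>K i\<close> into a product are pairs of arrows into its
  factors.\<close>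

lemma hom_counts_mult:
  assumes "X \<in> Dec \<C>" "Y \<in> Dec \<C>"
  shows "hom_counts \<C> I K (Dec_mult \<C> X Y) =
    (\<lambda>i\<in>I. hom_counts \<C> I K X i * hom_counts \<C> I K Y i)"
proof -
  obtain A where A: "A \<in> Obj \<C>" "X = iso_class \<C> A" using Dec_cases[OF assms(1)] .
  obtain B where B: "B \<in> Obj \<C>" "Y = iso_class \<C> B" using Dec_cases[OF assms(2)] .
  obtain p q where P: "is_product \<C> A B (prod_obj \<C> A B) p q"
    using is_product_prod_obj[OF products A(1) B(1)] .
  then have "prod_obj \<C> A B \<in> Obj \<C>" by (simp add: is_product_def)
  then show ?thesis
    using A B card_Hom_product[OF P]
    by (simp add: Dec_mult_class[OF products] hom_counts_class cong: restrict_cong)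
qed

lemma hom_counts_terminal:
  shows "iso_class \<C> (terminal_obj \<C>) \<in> Dec \<C>"
    and "hom_counts \<C> I K (iso_class \<C> (terminal_obj \<C>)) = (\<lambda>i\<in>I. 1)"
proof -
  have T: "is_terminal \<C> (terminal_obj \<C>)" using is_terminal_terminal_obj[OF products] .
  then have TO: "terminal_obj \<C> \<in> Obj \<C>" by (simp add: is_terminal_def)
  show "iso_class \<C> (terminal_obj \<C>) \<in> Dec \<C>" using TO by (rule iso_class_in_Dec)
  have "card (Hom \<C> (K i) (terminal_obj \<C>)) = 1" if "i \<in> I" for i
    using card_Hom_terminal[OF T] connected_K[OF that] by (simp add: connected_obj_def)
  then show "hom_counts \<C> I K (iso_class \<C> (terminal_obj \<C>)) = (\<lambda>i\<in>I. 1)"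
    unfolding hom_counts_class[OF TO] by (simp cong: restrict_cong)
qed

lemma semiring_morphism_hom_counts:
  "semiring_morphism (Dec_semiring \<C>) (product_semiring I (\<lambda>_. nat_semiring)) (hom_counts \<C> I K)"
proof -
  let ?N = "product_semiring I (\<lambda>_. nat_semiring)"
  note defs = Dec_semiring_def product_semiring_def nat_semiring_def
  have h: "hom_counts \<C> I K \<in> ring_hom (Dec_semiring \<C>) ?N"
    using hom_counts_PiE
    by (auto simp: ring_hom_def defs hom_counts_add hom_counts_mult hom_counts_terminal)
  have zero: "hom_counts \<C> I K \<zero>\<^bsub>Dec_semiring \<C>\<^esub> = \<zero>\<^bsub>?N\<^esub>"
    by (simp add: defs hom_counts_initial)
  \<comment> \<open>Distributivity and annihilation by zero hold pointwise in the power of the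
    natural numbers and are pulled back with the other laws.\<close>
  have "comm_semiring (Dec_semiring \<C>)"
    by (rule comm_semiring_of_inj_hom[OF comm_semiring_nat_power h zero])
      (simp_all add: Dec_semiring_def inj_on_hom_counts Dec_add_closed Dec_mult_closed
        hom_counts_initial hom_counts_terminal)
  with h zero show ?thesis by (simp add: semiring_morphism_def comm_semiring_nat_power)
qed

end

end

theorem theorem1p12:
  fixes \<C> :: "('o, 'm) category" and I :: "'i set" and K :: "'i \<Rightarrow> 'o"
  assumes "category \<C>" and "locally_finite \<C>" and "extensive \<C>" and "combinatorial \<C>"
    and "connected_representatives \<C> I K"
  shows "(monoid_morphism (Dec_monoid \<C>) (product_group I (\<lambda>_. nat_monoid)) (hom_counts \<C> I K) \<and>
          inj_on (hom_counts \<C> I K) (Dec \<C>)) \<and>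
         (has_finite_products \<C> \<longrightarrow>
          semiring_morphism (Dec_semiring \<C>) (product_semiring I (\<lambda>_. nat_semiring))
            (hom_counts \<C> I K) \<and>
          inj_on (hom_counts \<C> I K) (Dec \<C>))"
proof -
  interpret combinatorial_extensive_category \<C> I K
    using assms
    by (simp add: combinatorial_extensive_category_def combinatorial_extensive_category_axioms_def
        locally_finite_extensive_category_def locally_finite_extensive_category_axioms_def
        extensive_category_def extensive_category_axioms_def)
  show ?thesis
    using monoid_morphism_hom_counts semiring_morphism_hom_counts inj_on_hom_counts by blast
qed

end
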